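(* Let $p$ be a prime and $k$ be a positive integer. Then $A(p^k)\in\mathbb{Z}$ if and only if $\operatorname{rad}(k+1)$ divides $p^{\Delta(k+1)}-1$.
   Context: For a positive integer $n$, $A(n)=\sigma(n)/\tau(n)$ is the arithmetic mean of the positive divisors of $n$ ($\sigma(n)$ is the sum and $\tau(n)$ the number of positive divisors of $n$). For an integer $n\ge 2$ with prime power decomposition $n=q_1^{m_1}\cdots q_r^{m_r}$ (distinct primes $q_j$, exponents $m_j\ge 1$): $\operatorname{rad}(n)=q_1\cdots q_r$; $d_j(n)=\gcd(q_j-1,n)$ for $j=1,\dots,r$; and $\Delta(n)=\operatorname{lcm}(d_1(n),\dots,d_r(n))$. *)

theory Defs
  imports Complex_Main "HOL-Computational_Algebra.Primes"
begin

definition divisor_sum :: "nat \<Rightarrow> nat" where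
  "divisor_sum n = (\<Sum>d | d dvd n. d)"

definition divisor_count :: "nat \<Rightarrow> nat" where
  "divisor_count n = card {d. d dvd n}"

definition divisor_mean :: "nat \<Rightarrow> rat" where
  "divisor_mean n = of_nat (divisor_sum n) / of_nat (divisor_count n)"

definition rad :: "nat \<Rightarrow> nat" where
  "rad n = \<Prod>(prime_factors n)"

(* Every prime factor satisfies q >= 2, so the subtraction on nat does not truncate. *)
definition Delta :: "nat \<Rightarrow> nat" where
  "Delta n = (LCM q\<in>prime_factors n. gcd (q - 1) n)"

end

theory Submission
  imports Defs "HOL-Number_Theory.Pocklington"
begin

text \<open>
  Put \<open>n = k + 1\<close> and write \<open>S\<^sub>n(a) = 1 + a + \<dots> + a\<^bsup>n-1\<^esup>\<close>. The divisors of \<open>p\<^sup>k\<close> are the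
  \<open>n\<close> powers \<open>1, p, \<dots>, p\<^sup>k\<close>, so the mean is an integer exactly when \<open>n\<close> divides \<open>S\<^sub>n(p)\<close>.

  The surprise in the criterion is that only the primes dividing \<open>n\<close> matter, not their
  multiplicities: \<open>n\<close> divides \<open>S\<^sub>n(a)\<close> as soon as \<open>a\<^sup>n \<equiv> 1\<close> modulo each prime \<open>q\<close> dividing \<open>n\<close>
  (\<open>dvd_geometric_sum_iff\<close>). The reason is the factorisation
  \<open>S\<^bsub>eM\<^esub>(a) = S\<^sub>e(a) S\<^sub>M(a\<^sup>e)\<close>, taken with \<open>e\<close> the order of \<open>a\<close> modulo \<open>q\<close>. This order divides
  \<open>n\<close>, and it divides \<open>q - 1\<close>, hence is prime to \<open>q\<close>; so the full power of \<open>q\<close> in \<open>n\<close> survives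
  in \<open>M = n / e\<close>. Since \<open>a\<^sup>e \<equiv> 1\<close> modulo \<open>q\<close>, that power of \<open>q\<close> divides \<open>S\<^sub>M(a\<^sup>e)\<close>
  (\<open>power_dvd_geometric_sum\<close>).

  It remains to replace the exponent \<open>n\<close> by \<open>\<Delta>(n)\<close>. Once \<open>a\<close> is prime to \<open>q\<close>, its order modulo \<open>q\<close> divides
  \<open>q - 1\<close>, so if it divides \<open>n\<close> it divides \<open>gcd (q - 1) n\<close> and therefore \<open>\<Delta>(n)\<close>; conversely
  \<open>\<Delta>(n)\<close> divides \<open>n\<close> (\<open>cong_power_Delta_iff\<close>).
\<close>

section \<open>Divisibility of geometric sums\<close>

lemma geometric_sum_mult:
  fixes a :: "'a :: comm_semiring_1"
  shows "(\<Sum>i<e * m. a ^ i) = (\<Sum>i<e. a ^ i) * (\<Sum>i<m. (a ^ e) ^ i)"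
proof -
  have "(\<Sum>i<m * e. a ^ i) = (\<Sum>j<m. \<Sum>i\<in>{j * e..<j * e + e}. a ^ i)"
    by (rule sum.nat_group [symmetric])
  also have "\<dots> = (\<Sum>j<m. (a ^ e) ^ j * (\<Sum>i<e. a ^ i))"
  proof (rule sum.cong [OF refl])
    fix j
    have "(\<Sum>i\<in>{j * e..<j * e + e}. a ^ i) = (\<Sum>i<e. a ^ (i + j * e))"
      using sum.shift_bounds_nat_ivl [of "\<lambda>i. a ^ i" 0 "j * e" e]
      by (simp add: atLeast0LessThan add.commute)
    also have "\<dots> = (a ^ e) ^ j * (\<Sum>i<e. a ^ i)"
      by (simp add: sum_distrib_left sum_distrib_right power_add mult.commute flip: power_mult)
    finally show "(\<Sum>i\<in>{j * e..<j * e + e}. a ^ i) = (a ^ e) ^ j * (\<Sum>i<e. a ^ i)" .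
  qed
  finally show ?thesis
    by (simp add: mult.commute sum_distrib_left)
qed

text \<open>
  Multiplying \<open>S\<^sub>n(a)\<close> by \<open>a - 1\<close> gives \<open>a\<^sup>n - 1\<close>. The converse fails, because \<open>q\<close> may divide
  the factor \<open>a - 1\<close> instead of the sum.
\<close>

lemma cong_power_1_if_dvd_geometric_sum:
  fixes a n q :: nat
  assumes "q dvd (\<Sum>i<n. a ^ i)"
  shows "[a ^ n = 1] (mod q)"
proof -
  have "a * (\<Sum>i<n. a ^ i) + 1 = (\<Sum>i<n. a ^ i) + a ^ n"
    by (induction n) (simp_all add: algebra_simps)
  moreover have "[a * (\<Sum>i<n. a ^ i) + 1 = 0 + 1] (mod q)"
    using assms by (intro cong_add cong_refl) (simp add: cong_0_iff)
  moreover have "[(\<Sum>i<n. a ^ i) + a ^ n = 0 + a ^ n] (mod q)"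
    using assms by (intro cong_add cong_refl) (simp add: cong_0_iff)
  ultimately show ?thesis
    by (metis add_0 cong_sym cong_trans)
qed

text \<open>
  Each factor \<open>q\<close> of the length contributes a factor \<open>S\<^sub>q(b)\<close> with \<open>b \<equiv> 1\<close>, which is a sum of
  \<open>q\<close> terms congruent to 1.
\<close>

lemma power_dvd_geometric_sum:
  fixes a q m t :: nat
  assumes "[a = 1] (mod q)"
  shows "q ^ m dvd (\<Sum>i<q ^ m * t. a ^ i)"
  using assms
proof (induction m arbitrary: a)
  case 0
  show ?case by simp
next
  case (Suc m)
  have "[(\<Sum>i<q. a ^ i) = (\<Sum>i<q. 1)] (mod q)"
  proof (rule cong_sum)
    fix i
    show "[a ^ i = 1] (mod q)"
      using cong_pow [OF Suc.prems, of i] by simp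
  qed
  then have "q dvd (\<Sum>i<q. a ^ i)"
    by (simp add: cong_dvd_iff)
  moreover have "q ^ m dvd (\<Sum>i<q ^ m * t. (a ^ q) ^ i)"
    using cong_pow [OF Suc.prems, of q] by (intro Suc.IH) simp
  ultimately show ?case
    using geometric_sum_mult [where a = a and e = q and m = "q ^ m * t"]
    by (simp add: mult.assoc mult_dvd_mono)
qed

lemma coprime_if_cong_power_1:
  fixes a n q :: nat
  assumes "[a ^ n = 1] (mod q)" and "n > 0"
  shows "coprime q a"
proof -
  have "coprime (a ^ n) q"
    using cong_imp_coprime [OF cong_sym [OF assms(1)]] by simp
  with assms(2) show ?thesis
    by (simp add: coprime_commute)
qed

lemma ord_dvd_prime_minus_1:
  assumes "prime q" and "coprime q a"
  shows "ord q a dvd q - 1"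
  using order_divides_totient [OF assms(2)] assms(1) by (simp add: totient_prime)

lemma dvd_if_prime_powers_dvd:
  fixes n x :: nat
  assumes "n > 0" and "\<And>q. q \<in> prime_factors n \<Longrightarrow> q ^ multiplicity q n dvd x"
  shows "n dvd x"
proof (cases "x = 0")
  case False
  show ?thesis
  proof (rule multiplicity_le_imp_dvd)
    fix q :: nat
    assume q: "prime q"
    show "multiplicity q n \<le> multiplicity q x"
    proof (cases "q dvd n")
      case True
      then have "q ^ multiplicity q n dvd x"
        using assms q by (simp add: in_prime_factors_iff)
      then show ?thesis
        using False q by (intro multiplicity_geI) auto
    qed (simp add: not_dvd_imp_multiplicity_0)
  qed (use assms in simp)
qed simp

text \<open>
  A prime \<open>q\<close> may divide \<open>n\<close> while \<open>a \<equiv> 1\<close> fails modulo \<open>q\<close>, so \<open>power_dvd_geometric_sum\<close>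
  cannot be applied to \<open>a\<close> itself. Passing to \<open>a\<^sup>e\<close>, with \<open>e\<close> the order of \<open>a\<close>, treats all
  primes alike; the price is a sum shortened to length \<open>n / e\<close>, and it costs no factor \<open>q\<close>
  because \<open>e\<close> divides \<open>q - 1\<close>.
\<close>

theorem dvd_geometric_sum_iff:
  fixes a n :: nat
  assumes "n > 0"
  shows "n dvd (\<Sum>i<n. a ^ i) \<longleftrightarrow> (\<forall>q\<in>prime_factors n. [a ^ n = 1] (mod q))"
proof
  assume "n dvd (\<Sum>i<n. a ^ i)"
  then show "\<forall>q\<in>prime_factors n. [a ^ n = 1] (mod q)"
    using cong_power_1_if_dvd_geometric_sum dvd_trans by (blast dest: in_prime_factors_imp_dvd)
next
  assume R: "\<forall>q\<in>prime_factors n. [a ^ n = 1] (mod q)"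
  show "n dvd (\<Sum>i<n. a ^ i)"
  proof (rule dvd_if_prime_powers_dvd [OF assms])
    fix q
    assume "q \<in> prime_factors n"
    with R have q: "prime q" and cong: "[a ^ n = 1] (mod q)"
      by auto
    define e m where "e = ord q a" and "m = multiplicity q n"
    have "coprime q a"
      using cong assms by (rule coprime_if_cong_power_1)
    with q have "e dvd q - 1"
      unfolding e_def by (rule ord_dvd_prime_minus_1)
    moreover have "coprime q (q - 1)"
      using coprime_diff_one_right_nat [OF prime_gt_0_nat [OF q]] .
    ultimately have "coprime e (q ^ m)"
      by (metis coprime_commute coprime_divisors coprime_power_right_iff dvd_refl)
    moreover have "e dvd n"
      using cong unfolding e_def ord_divides .
    moreover have "q ^ m dvd n"
      by (simp add: m_def multiplicity_dvd)
    ultimately have "e * q ^ m dvd n"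
      by (intro divides_mult)
    then obtain t where "n = e * q ^ m * t"
      by (rule dvdE)
    then have "n = e * (q ^ m * t)"
      by (simp only: mult.assoc)
    then have "(\<Sum>i<n. a ^ i) = (\<Sum>i<e. a ^ i) * (\<Sum>i<q ^ m * t. (a ^ e) ^ i)"
      by (simp only: geometric_sum_mult)
    moreover have "q ^ m dvd (\<Sum>i<q ^ m * t. (a ^ e) ^ i)"
      by (rule power_dvd_geometric_sum) (simp only: e_def ord)
    ultimately show "q ^ multiplicity q n dvd (\<Sum>i<n. a ^ i)"
      by (simp add: m_def)
  qed
qed

section \<open>The exponent \<open>\<Delta>(n)\<close> and the radical\<close>

lemma Delta_dvd: "Delta n dvd n"
  unfolding Delta_def by (rule Lcm_least) auto

text \<open>
  Both exponents are tested by the order of \<open>a\<close> modulo \<open>q\<close>. Either congruence makes \<open>a\<close>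
  prime to \<open>q\<close>, so that order divides \<open>q - 1\<close> by Fermat; hence only the part
  of \<open>n\<close> shared with \<open>q - 1\<close> counts, and \<open>\<Delta>(n)\<close> contains this part for every prime \<open>q\<close>
  at once.
\<close>

lemma cong_power_Delta_iff:
  fixes a n q :: nat
  assumes "n > 0" and "q \<in> prime_factors n"
  shows "[a ^ Delta n = 1] (mod q) \<longleftrightarrow> [a ^ n = 1] (mod q)"
proof
  assume "[a ^ Delta n = 1] (mod q)"
  then show "[a ^ n = 1] (mod q)"
    using Delta_dvd dvd_trans unfolding ord_divides by blast
next
  assume cong: "[a ^ n = 1] (mod q)"
  have "prime q"
    using assms(2) by auto
  then have "ord q a dvd q - 1"
    using coprime_if_cong_power_1 [OF cong assms(1)] by (rule ord_dvd_prime_minus_1)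
  then have "ord q a dvd gcd (q - 1) n"
    using cong unfolding ord_divides by (rule gcd_greatest)
  also have "\<dots> dvd Delta n"
    unfolding Delta_def using assms(2) by (intro dvd_Lcm) auto
  finally show "[a ^ Delta n = 1] (mod q)"
    by (simp only: ord_divides)
qed

lemma prod_primes_dvd_iff:
  fixes x :: nat
  assumes "finite Q" and "\<And>q. q \<in> Q \<Longrightarrow> prime q"
  shows "\<Prod>Q dvd x \<longleftrightarrow> (\<forall>q\<in>Q. q dvd x)"
  using assms
proof (induction rule: finite_induct)
  case (insert q Q)
  have "coprime q (\<Prod>Q)"
    using insert.hyps insert.prems by (intro prod_coprime_right) (auto intro!: primes_coprime)
  then have "q * \<Prod>Q dvd x \<longleftrightarrow> q dvd x \<and> \<Prod>Q dvd x"
    by (auto intro: divides_mult dest: dvd_mult_left dvd_mult_right)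
  with insert show ?case
    by simp
qed simp

lemma rad_dvd_iff: "rad n dvd x \<longleftrightarrow> (\<forall>q\<in>prime_factors n. q dvd x)"
  unfolding rad_def by (rule prod_primes_dvd_iff) auto

section \<open>The divisor mean of a prime power\<close>

lemma of_nat_div_of_nat_in_Ints_iff:
  fixes a b :: nat
  assumes "b > 0"
  shows "(of_nat a / of_nat b :: 'a :: field_char_0) \<in> \<int> \<longleftrightarrow> b dvd a"
  using of_int_div_of_int_in_Ints_iff [of "int a" "int b", where ?'a = 'a] assms by simp

lemma divisors_prime_power:
  fixes p k :: nat
  assumes "prime p"
  shows "{d. d dvd p ^ k} = (\<lambda>i. p ^ i) ` {..<k + 1}"
  using divides_primepow_nat [OF assms] by (auto simp: less_Suc_eq_le)

lemma divisor_mean_prime_power_in_Ints_iff: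
  fixes p k :: nat
  assumes "prime p"
  shows "divisor_mean (p ^ k) \<in> \<int> \<longleftrightarrow> k + 1 dvd (\<Sum>i<k + 1. p ^ i)"
proof -
  have inj: "inj_on (\<lambda>i. p ^ i) {..<k + 1}"
    using prime_gt_1_nat [OF assms] by (auto intro: inj_onI)
  have "divisor_sum (p ^ k) = (\<Sum>i<k + 1. p ^ i)"
    unfolding divisor_sum_def divisors_prime_power [OF assms] by (simp only: sum.reindex [OF inj] o_def)
  moreover have "divisor_count (p ^ k) = k + 1"
    unfolding divisor_count_def divisors_prime_power [OF assms] by (simp only: card_image [OF inj] card_lessThan)
  ultimately show ?thesis
    unfolding divisor_mean_def by (simp only: of_nat_div_of_nat_in_Ints_iff)
qed

theorem theorem2:
  fixes p k :: nat
  assumes "prime p" and "k > 0"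
  shows "divisor_mean (p ^ k) \<in> \<int> \<longleftrightarrow> rad (k + 1) dvd p ^ Delta (k + 1) - 1"
proof -
  have "divisor_mean (p ^ k) \<in> \<int> \<longleftrightarrow> (\<forall>q\<in>prime_factors (k + 1). [p ^ (k + 1) = 1] (mod q))"
    by (simp only: divisor_mean_prime_power_in_Ints_iff [OF assms(1)] dvd_geometric_sum_iff)
  also have "\<dots> \<longleftrightarrow> (\<forall>q\<in>prime_factors (k + 1). [p ^ Delta (k + 1) = 1] (mod q))"
    using cong_power_Delta_iff by simp
  also have "\<dots> \<longleftrightarrow> (\<forall>q\<in>prime_factors (k + 1). q dvd p ^ Delta (k + 1) - 1)"
    using prime_gt_0_nat [OF assms(1)] by (simp add: cong_altdef_nat)
  also have "\<dots> \<longleftrightarrow> rad (k + 1) dvd p ^ Delta (k + 1) - 1"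
    by (simp only: rad_dvd_iff)
  finally show ?thesis .
qed

end
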